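(* Let $\kappa<\lambda$ be cardinals and let $U$ be a normal, fine ultrafilter on $P_\kappa(\lambda)$. Suppose that $2^{<\lambda}=\lambda$ and $\mathrm{cf}(\lambda)>\kappa$. Then $\lnot\mathrm{Gal}(U,\kappa,2^\lambda)$; that is, there is a sequence $\langle A_i : i<2^\lambda\rangle$ of sets in $U$ such that for every $I\subseteq 2^\lambda$ with $|I|=\kappa$, $\bigcap_{i\in I}A_i\notin U$.
   Context: $P_\kappa(\lambda)=\{x\subseteq\lambda : |x|<\kappa\}$. An ultrafilter $U$ on $P_\kappa(\lambda)$ is fine if $\{x\in P_\kappa(\lambda):\alpha\in x\}\in U$ for every $\alpha<\lambda$, and normal if whenever $X_\alpha\in U$ for $\alpha<\lambda$, the diagonal intersection $\triangle_{\alpha<\lambda}X_\alpha=\{x\in P_\kappa(\lambda):\forall\alpha\in x\,(x\in X_\alpha)\}$ is in $U$. For a filter $F$ and cardinals $\mu\le\nu$, $\mathrm{Gal}(F,\mu,\nu)$ means: for every sequence $\langle A_i:i<\nu\rangle$ of sets in $F$ there is $I\subseteq\nu$ with $|I|=\mu$ such that $\bigcap_{i\in I}A_i\in F$. *)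

theory Defs
  imports Main
begin

unbundle cardinal_syntax

(* Cardinals are the cardinal orders of the BNF library, that is, well-orders r with Card_order r;
   equality and order of cardinals are =o, <=o and <o.  The ordinals below r are the elements of
   Field r, ordered by r. *)

definition Pk :: "'b rel \<Rightarrow> 'a rel \<Rightarrow> 'a set set" where
  "Pk \<kappa> l = {x. x \<subseteq> Field l \<and> |x| <o \<kappa>}"

definition filter_on :: "'c set \<Rightarrow> 'c set set \<Rightarrow> bool" where
  "filter_on S F \<longleftrightarrow> F \<subseteq> Pow S \<and> S \<in> F \<and> {} \<notin> F
     \<and> (\<forall>X\<in>F. \<forall>Y\<in>F. X \<inter> Y \<in> F)
     \<and> (\<forall>X\<in>F. \<forall>Y. X \<subseteq> Y \<and> Y \<subseteq> S \<longrightarrow> Y \<in> F)"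

definition ultrafilter_on :: "'c set \<Rightarrow> 'c set set \<Rightarrow> bool" where
  "ultrafilter_on S U \<longleftrightarrow> filter_on S U \<and> (\<forall>X. X \<subseteq> S \<longrightarrow> X \<in> U \<or> S - X \<in> U)"

definition fine :: "'b rel \<Rightarrow> 'a rel \<Rightarrow> 'a set set set \<Rightarrow> bool" where
  "fine \<kappa> l U \<longleftrightarrow> (\<forall>\<alpha>\<in>Field l. {x \<in> Pk \<kappa> l. \<alpha> \<in> x} \<in> U)"

definition diag_inter :: "'b rel \<Rightarrow> 'a rel \<Rightarrow> ('a \<Rightarrow> 'a set set) \<Rightarrow> 'a set set" where
  "diag_inter \<kappa> l X = {x \<in> Pk \<kappa> l. \<forall>\<alpha>\<in>x. x \<in> X \<alpha>}"

definition normal :: "'b rel \<Rightarrow> 'a rel \<Rightarrow> 'a set set set \<Rightarrow> bool" where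
  "normal \<kappa> l U \<longleftrightarrow> (\<forall>X. (\<forall>\<alpha>\<in>Field l. X \<alpha> \<in> U) \<longrightarrow> diag_inter \<kappa> l X \<in> U)"

(* Galvin's property of a filter F on S.  The intersection is taken inside S, so that the empty
   family (possible only for m = 0) has intersection S rather than UNIV. *)
definition Gal :: "'c set \<Rightarrow> 'c set set \<Rightarrow> 'm rel \<Rightarrow> 'n rel \<Rightarrow> bool" where
  "Gal S F m n \<longleftrightarrow> (\<forall>A. (\<forall>i\<in>Field n. A i \<in> F) \<longrightarrow>
     (\<exists>I. I \<subseteq> Field n \<and> |I| =o m \<and> S \<inter> (\<Inter>i\<in>I. A i) \<in> F))"

(* Cofinal is meant in the weak sense, so that cf of a nonzero finite ordinal is 1.  The library's
   cofinal is strict: it agrees for orders without a greatest element, and no set at all is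
   strictly cofinal in an order that has one. *)
definition weakly_cofinal :: "'a set \<Rightarrow> 'a rel \<Rightarrow> bool" where
  "weakly_cofinal A r \<longleftrightarrow> A \<subseteq> Field r \<and> (\<forall>a\<in>Field r. \<exists>b\<in>A. (a, b) \<in> r)"

definition cofinality :: "'a rel \<Rightarrow> 'a rel" where
  "cofinality r =
     |SOME A. weakly_cofinal A r \<and> (\<forall>B. weakly_cofinal B r \<longrightarrow> |A| \<le>o |B| )|"

definition is_card_sup :: "'a rel set \<Rightarrow> 'a rel \<Rightarrow> bool" where
  "is_card_sup R s \<longleftrightarrow> Card_order s \<and> (\<forall>r\<in>R. r \<le>o s)
     \<and> (\<forall>t :: 'a rel. Card_order t \<and> (\<forall>r\<in>R. r \<le>o t) \<longrightarrow> s \<le>o t)"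

(* The weak power 2^{<l}: the supremum of the cardinals 2^m for cardinals m < l.  Every cardinal
   below l is represented on the type of l, and 2^l bounds the family on the type of the 2^m, so
   the choice is well defined up to =o (lemma weak_power_is_sup). *)
definition weak_power :: "'a rel \<Rightarrow> ('a \<Rightarrow> bool) rel" where
  "weak_power l = (SOME s. is_card_sup {ctwo ^c m | m :: 'a rel. Card_order m \<and> m <o l} s)"

lemma cofinality_witness:
  assumes "Well_order r"
  shows "\<exists>A. weakly_cofinal A r \<and> (\<forall>B. weakly_cofinal B r \<longrightarrow> |A| \<le>o |B| ) \<and> cofinality r = |A|"
proof -
  let ?R = "{ |A| | A. weakly_cofinal A r}"
  have "refl_on (Field r) r"
    using assms by (simp add: order_on_defs)
  then have "weakly_cofinal (Field r) r"
    unfolding weakly_cofinal_def by (auto dest: refl_onD)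
  then have "?R \<noteq> {}" by blast
  moreover have "\<forall>s\<in>?R. Card_order s" using card_of_Card_order by blast
  ultimately have "\<exists>s\<in>?R. \<forall>s'\<in>?R. s \<le>o s'"
    by (intro exists_minim_Card_order) auto
  then have "\<exists>A. weakly_cofinal A r \<and> (\<forall>B. weakly_cofinal B r \<longrightarrow> |A| \<le>o |B| )" by blast
  from someI_ex[OF this] show ?thesis unfolding cofinality_def by blast
qed

lemma card_sup_ex:
  fixes R :: "'a rel set" and b :: "'a rel"
  assumes "Card_order b" "\<forall>r\<in>R. r \<le>o b"
  shows "\<exists>s. is_card_sup R s"
proof -
  let ?B = "{t :: 'a rel. Card_order t \<and> (\<forall>r\<in>R. r \<le>o t)}"
  have "\<exists>s\<in>?B. \<forall>t\<in>?B. s \<le>o t"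
    using assms by (intro exists_minim_Card_order) auto
  then obtain s where "s \<in> ?B" and "\<forall>t\<in>?B. s \<le>o t" by (rule bexE)
  then have "is_card_sup R s" unfolding is_card_sup_def by simp
  then show ?thesis by (rule exI)
qed

lemma weak_power_is_sup:
  fixes l :: "'a rel"
  assumes "Card_order l"
  shows "is_card_sup {ctwo ^c m | m :: 'a rel. Card_order m \<and> m <o l} (weak_power l)"
proof -
  have "ctwo ^c m \<le>o ctwo ^c l" if m: "Card_order m" "m <o l" for m :: "'a rel"
  proof (cases "Field m = {}")
    case False
    then show ?thesis
      using cexp_mono2'[OF ordLess_imp_ordLeq[OF m(2)] Card_order_ctwo] by blast
  next
    case True
    have "Field m = {} \<Longrightarrow> Func (Field m) (UNIV :: bool set) = {\<lambda>x. undefined}"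
      by (auto simp: Func_def)
    moreover have "Func (Field l) (UNIV :: bool set) \<noteq> {}"
      by (simp add: Func_is_emp)
    ultimately show ?thesis
      using True by (simp add: cexp_def ctwo_def Field_card_of card_of_singl_ordLeq)
  qed
  then have "\<exists>s. is_card_sup {ctwo ^c m | m :: 'a rel. Card_order m \<and> m <o l} s"
    by (intro card_sup_ex[of "ctwo ^c l"] Card_order_cexp) auto
  then show ?thesis unfolding weak_power_def by (rule someI_ex)
qed

end

theory Submission
  imports Defs
begin

text \<open>
  Since \<open>2\<^sup><\<^sup>\<lambda> = \<lambda>\<close>, the bounded subsets of \<open>\<lambda>\<close> can be enumerated as \<open>a\<^sub>\<alpha>\<close> with \<open>\<alpha> < \<lambda>\<close>.
  For \<open>X \<subseteq> \<lambda>\<close> let \<open>A\<^sub>X\<close> consist of the \<open>x\<close> such that for all \<open>\<beta> \<in> x\<close> the set \<open>X \<inter> \<beta>\<close> is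
  some \<open>a\<^sub>\<alpha>\<close> with \<open>\<alpha> \<in> x\<close>; by fineness and normality \<open>A\<^sub>X \<in> U\<close>.  As \<open>cf(\<lambda>) > \<kappa>\<close>, any \<open>\<kappa>\<close> many
  distinct sets \<open>X\<close> already differ pairwise below a single \<open>\<beta> < \<lambda>\<close>.  A point \<open>x\<close> with
  \<open>\<beta> \<in> x\<close> in the intersection of their sets \<open>A\<^sub>X\<close> would have at least \<open>\<kappa>\<close> elements.
\<close>

lemma fine_finite_subset:
  assumes U: "ultrafilter_on (Pk \<kappa> l) U" "fine \<kappa> l U"
    and "finite F" "F \<subseteq> Field l"
  shows "{x \<in> Pk \<kappa> l. F \<subseteq> x} \<in> U"
  using assms(3,4)
proof (induction F rule: finite_induct)
  case empty
  then show ?case using U(1) by (simp add: ultrafilter_on_def filter_on_def)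
next
  case (insert a F)
  have "{x \<in> Pk \<kappa> l. a \<in> x} \<in> U"
    using U(2) insert.prems by (simp add: fine_def)
  moreover have "{x \<in> Pk \<kappa> l. F \<subseteq> x} \<in> U"
    using insert by simp
  ultimately have "{x \<in> Pk \<kappa> l. a \<in> x} \<inter> {x \<in> Pk \<kappa> l. F \<subseteq> x} \<in> U"
    using U(1) by (simp add: ultrafilter_on_def filter_on_def)
  also have "{x \<in> Pk \<kappa> l. a \<in> x} \<inter> {x \<in> Pk \<kappa> l. F \<subseteq> x} = {x \<in> Pk \<kappa> l. insert a F \<subseteq> x}"
    by auto
  finally show ?case .
qed

text \<open>A finite \<open>\<kappa>\<close> would embed into \<open>Field l\<close> as a finite
  set. Fineness and finite intersections then give a point of \<open>Pk \<kappa> l\<close>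
  containing the image, which is too large for it.\<close>

lemma fine_imp_infinite:
  assumes U: "ultrafilter_on (Pk \<kappa> l) U" "fine \<kappa> l U"
    and \<kappa>: "Card_order \<kappa>" and l: "Card_order l" and less: "\<kappa> <o l"
  shows "infinite (Field \<kappa>)"
proof
  assume fin: "finite (Field \<kappa>)"
  have eq: "|Field \<kappa>| =o \<kappa>"
    using \<kappa> by (rule card_of_Field_ordIso)
  have "|Field \<kappa>| \<le>o |Field l|"
    using less \<kappa> l by (simp add: ordLess_imp_ordLeq card_of_mono2)
  then obtain f where f: "inj_on f (Field \<kappa>)" "f ` Field \<kappa> \<subseteq> Field l"
    by (auto simp: card_of_ordLeq[symmetric])
  have "{x \<in> Pk \<kappa> l. f ` Field \<kappa> \<subseteq> x} \<in> U"
    using U fin f(2) by (intro fine_finite_subset) auto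
  then have "{x \<in> Pk \<kappa> l. f ` Field \<kappa> \<subseteq> x} \<noteq> {}"
    using U(1) unfolding ultrafilter_on_def filter_on_def by metis
  then obtain x where x: "x \<in> Pk \<kappa> l" "f ` Field \<kappa> \<subseteq> x" by blast
  have "|Field \<kappa>| \<le>o |x|"
    using f(1) x(2) card_of_ordLeq by blast
  then have "\<kappa> \<le>o |x|"
    using eq ordIso_ordLeq_trans ordIso_symmetric by blast
  with x(1) show False
    unfolding Pk_def using not_ordLess_ordLeq by blast
qed

text \<open>Proper initial segments of the cardinal \<open>l\<close> are smaller than
  \<open>l\<close>, so each power set has size at most \<open>weak_power l =o l\<close>; a union of
  \<open>l\<close> many such sets has size at most \<open>l\<close>.\<close>

lemma card_bounded_subsets:
  fixes l :: "'a rel"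
  assumes l: "Card_order l" "infinite (Field l)" and wp: "weak_power l =o l"
  shows "|\<Union>\<beta>\<in>Field l. Pow (underS l \<beta>)| \<le>o l"
proof (rule card_of_UNION_ordLeq_infinite_Field[OF l(2,1)])
  show "|Field l| \<le>o l"
    using l(1) by (simp add: card_of_Field_ordIso ordIso_imp_ordLeq)
  show "\<forall>\<beta>\<in>Field l. |Pow (underS l \<beta>)| \<le>o l"
  proof
    fix \<beta> assume "\<beta> \<in> Field l"
    then have "|underS l \<beta>| <o l" using l(1) by (rule card_of_underS[rotated])
    then have "ctwo ^c |underS l \<beta>| \<le>o weak_power l"
      using weak_power_is_sup[OF l(1)] card_of_Card_order unfolding is_card_sup_def by blast
    then have "ctwo ^c |underS l \<beta>| \<le>o l"
      using wp ordLeq_ordIso_trans by blast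
    moreover have "|Pow (underS l \<beta>)| =o ctwo ^c |underS l \<beta>|"
      unfolding cexp_def ctwo_def Field_card_of by (rule card_of_Pow_Func)
    ultimately show "|Pow (underS l \<beta>)| \<le>o l"
      using ordIso_ordLeq_trans by blast
  qed
qed

text \<open>Too small to be weakly cofinal, \<open>D\<close> misses the elements above some
  \<open>\<beta>\<close>, \<open>\<beta>\<close> included; by totality \<open>D\<close> lies
  strictly below this \<open>\<beta>\<close>.\<close>

lemma bounded_of_card_less_cofinality:
  assumes l: "Well_order l" and D: "D \<subseteq> Field l" "|D| <o cofinality l"
  obtains \<beta> where "\<beta> \<in> Field l" "D \<subseteq> underS l \<beta>"
proof -
  have "\<not> weakly_cofinal D l"
    using cofinality_witness[OF l] D(2) not_ordLess_ordLeq by metis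
  then obtain \<beta> where \<beta>: "\<beta> \<in> Field l" "\<forall>d\<in>D. (\<beta>, d) \<notin> l"
    using D(1) unfolding weakly_cofinal_def by blast
  have "refl_on (Field l) l" "total_on (Field l) l"
    using l by (auto simp: order_on_defs)
  then have "D \<subseteq> underS l \<beta>"
    using \<beta> D(1) unfolding underS_def by (fastforce simp: total_on_def dest: refl_onD)
  with \<beta>(1) show ?thesis by (rule that)
qed

text \<open>Choose for each pair of distinct indices a point \<open>d p\<close> where the two sets
  differ. As \<open>I\<close> is infinite there are at most \<open>|I|\<close> such points, so one
  \<open>\<beta>\<close> bounds them all.\<close>

lemma distinct_below_bound:
  assumes l: "Well_order l" and I: "infinite I" "|I| <o cofinality l"
    and X: "inj_on X I" "\<And>i. i \<in> I \<Longrightarrow> X i \<subseteq> Field l"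
  obtains \<beta> where "\<beta> \<in> Field l" "inj_on (\<lambda>i. X i \<inter> underS l \<beta>) I"
proof -
  let ?P = "{p \<in> I \<times> I. fst p \<noteq> snd p}"
  define d where "d p = (SOME c. c \<in> (X (fst p) - X (snd p)) \<union> (X (snd p) - X (fst p)))" for p
  have d: "d p \<in> (X (fst p) - X (snd p)) \<union> (X (snd p) - X (fst p))" if "p \<in> ?P" for p
  proof -
    have "X (fst p) \<noteq> X (snd p)"
      using that inj_on_eq_iff[OF X(1), of "fst p" "snd p"] by auto
    then have "\<exists>c. c \<in> (X (fst p) - X (snd p)) \<union> (X (snd p) - X (fst p))" by blast
    then show ?thesis unfolding d_def by (rule someI_ex)
  qed
  have "|d ` ?P| \<le>o |?P|" by (rule card_of_image)
  also have "|?P| \<le>o |I \<times> I|" by (rule card_of_mono1) blast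
  also have "|I \<times> I| =o |I|" using I(1) by (rule card_of_Times_same_infinite)
  finally have "|d ` ?P| <o cofinality l"
    using I(2) ordLeq_ordLess_trans by blast
  moreover have "d ` ?P \<subseteq> Field l"
    using d X(2) by fastforce
  ultimately obtain \<beta> where \<beta>: "\<beta> \<in> Field l" "d ` ?P \<subseteq> underS l \<beta>"
    using bounded_of_card_less_cofinality[OF l] by blast
  have "inj_on (\<lambda>i. X i \<inter> underS l \<beta>) I"
  proof (rule inj_onI, rule ccontr)
    fix i j assume ij: "i \<in> I" "j \<in> I" "X i \<inter> underS l \<beta> = X j \<inter> underS l \<beta>" "i \<noteq> j"
    then have p: "(i, j) \<in> ?P" by simp
    then have "d (i, j) \<in> underS l \<beta>" using \<beta>(2) by blast
    then show False using d[OF p] ij(3) by auto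
  qed
  with \<beta>(1) show ?thesis by (rule that)
qed

theorem theorem2p5:
  fixes \<kappa> :: "'b rel" and l :: "'a rel" and U :: "'a set set set"
  assumes "Card_order \<kappa>" and "Card_order l" and "\<kappa> <o l"
    and "ultrafilter_on (Pk \<kappa> l) U" and "fine \<kappa> l U" and "normal \<kappa> l U"
    and "weak_power l =o l"
    and "\<kappa> <o cofinality l"
  shows "\<not> Gal (Pk \<kappa> l) U \<kappa> (ctwo ^c l)"
proof
  assume gal: "Gal (Pk \<kappa> l) U \<kappa> (ctwo ^c l)"
  let ?S = "Pk \<kappa> l"
  note upward = assms(4)[unfolded ultrafilter_on_def filter_on_def]
  have wo: "Well_order l" using assms(2) by (rule card_order_on_well_order_on)
  have inf\<kappa>: "infinite (Field \<kappa>)"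
    using assms(1-5) by (intro fine_imp_infinite)
  have "|Field \<kappa>| \<le>o |Field l|"
    using assms(1-3) by (simp add: ordLess_imp_ordLeq card_of_mono2)
  then have infl: "infinite (Field l)"
    using inf\<kappa> card_of_ordLeq_infinite by blast

  let ?B = "\<Union>\<beta>\<in>Field l. Pow (underS l \<beta>)"
  have "|?B| \<le>o |Field l|"
    using card_bounded_subsets[OF assms(2) infl assms(7)] card_of_Field_ordIso[OF assms(2)]
      ordLeq_ordIso_trans ordIso_symmetric by blast
  moreover have "Field l \<noteq> {}" using infl by auto
  then have "?B \<noteq> {}" by blast
  \<comment> \<open>Nonemptiness of \<open>?B\<close> turns the cardinal inequality into a
    surjection.\<close>
  ultimately obtain a where a: "a ` Field l = ?B"
    using card_of_ordLeq2[of ?B "Field l"] by metis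

  \<comment> \<open>The indices in \<open>Field (ctwo ^c l)\<close> are characteristic functions on
    \<open>Field l\<close>.\<close>
  define X where "X i = {c \<in> Field l. i c}" for i :: "'a \<Rightarrow> bool"
  define A where "A i = diag_inter \<kappa> l (\<lambda>\<beta>. {x \<in> ?S. X i \<inter> underS l \<beta> \<in> a ` x})" for i
  have "A i \<in> U" for i
  proof -
    have "{x \<in> ?S. X i \<inter> underS l \<beta> \<in> a ` x} \<in> U" if "\<beta> \<in> Field l" for \<beta>
    proof -
      have "X i \<inter> underS l \<beta> \<in> a ` Field l" using that a by blast
      then obtain \<alpha> where \<alpha>: "\<alpha> \<in> Field l" "X i \<inter> underS l \<beta> = a \<alpha>" by blast
      then have "{x \<in> ?S. \<alpha> \<in> x} \<in> U" using assms(5) by (simp add: fine_def)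
      moreover have "{x \<in> ?S. \<alpha> \<in> x} \<subseteq> {x \<in> ?S. X i \<inter> underS l \<beta> \<in> a ` x}"
        using \<alpha>(2) by blast
      moreover have "{x \<in> ?S. X i \<inter> underS l \<beta> \<in> a ` x} \<subseteq> ?S" by blast
      ultimately show ?thesis using upward by blast
    qed
    then show ?thesis using assms(6) unfolding A_def normal_def by simp
  qed
  then obtain I where I: "I \<subseteq> Field (ctwo ^c l)" "|I| =o \<kappa>" "?S \<inter> (\<Inter>i\<in>I. A i) \<in> U"
    using gal unfolding Gal_def by meson
  have I\<kappa>: "|I| =o |Field \<kappa>|"
    using I(2) card_of_Field_ordIso[OF assms(1)] ordIso_symmetric ordIso_transitive by blast
  then have "infinite I" using inf\<kappa> card_of_ordIso_finite by blast
  moreover have "|I| <o cofinality l" using I(2) assms(8) ordIso_ordLess_trans by blast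
  moreover have "inj_on X I"
  proof (rule inj_onI)
    fix i j assume "i \<in> I" "j \<in> I" and eq: "X i = X j"
    \<comment> \<open>Members of \<open>Func\<close> all take the value \<open>undefined\<close> off
      \<open>Field l\<close>, so the set \<open>X i\<close> determines \<open>i\<close>.\<close>
    then have "i \<in> Func (Field l) UNIV" "j \<in> Func (Field l) UNIV"
      using I(1) by (auto simp: cexp_def ctwo_def Field_card_of)
    then show "i = j" using eq unfolding X_def Func_def by fastforce
  qed
  moreover have "X i \<subseteq> Field l" for i unfolding X_def by blast
  ultimately obtain \<beta> where \<beta>: "\<beta> \<in> Field l" "inj_on (\<lambda>i. X i \<inter> underS l \<beta>) I"
    using distinct_below_bound[OF wo] by metis
  \<comment> \<open>The diagonal intersection constrains \<open>x\<close> only at its own elements,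
    so \<open>\<beta> \<in> x\<close> must be secured.\<close>
  have "{x \<in> ?S. \<beta> \<in> x} \<in> U" using assms(5) \<beta>(1) by (simp add: fine_def)
  then have "(?S \<inter> (\<Inter>i\<in>I. A i)) \<inter> {x \<in> ?S. \<beta> \<in> x} \<in> U" using I(3) upward by blast
  then have "(?S \<inter> (\<Inter>i\<in>I. A i)) \<inter> {x \<in> ?S. \<beta> \<in> x} \<noteq> {}" using upward by metis
  then obtain x where x: "x \<in> ?S" "\<beta> \<in> x" "\<And>i. i \<in> I \<Longrightarrow> x \<in> A i" by blast
  \<comment> \<open>Each trace below \<open>\<beta>\<close> has a code in \<open>x\<close>; since
    the traces are distinct, \<open>x\<close> has at least \<open>|I|\<close> elements.\<close>
  have "(\<lambda>i. X i \<inter> underS l \<beta>) ` I \<subseteq> a ` x"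
    using x(2,3) unfolding A_def diag_inter_def by blast
  then have "|I| \<le>o |a ` x|" using \<beta>(2) card_of_ordLeq by blast
  also have "|a ` x| \<le>o |x|" by (rule card_of_image)
  finally have "\<kappa> \<le>o |x|" using I(2) ordIso_ordLeq_trans ordIso_symmetric by blast
  with x(1) show False unfolding Pk_def using not_ordLess_ordLeq by blast
qed

end
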